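(* Let $\mathcal F=(G_\alpha,d_\alpha,\varepsilon_\alpha)_{\alpha\in I}$ be an approximating family, let $\ell\geqslant 0$, $m\geqslant 1$, and fix elements $a_1^\alpha,\ldots,a_\ell^\alpha\in G_\alpha$ for each $\alpha\in I$. Let $W\subseteq\mathbb F_\ell\ast\mathbb F_m$ be a finite subset, let $G=\mathbb F_\ell\ast\mathbb F_m/\langle W\rangle$, and let $\rho\colon\mathbb F_\ell\ast\mathbb F_m\to G$ be the canonical projection. Then $G$ is constraint $\mathcal F$-approximable with respect to $a_1^\alpha,\ldots,a_\ell^\alpha\in G_\alpha$, $\alpha\in I$, if and only if for every integer $n\geqslant 1$ there exist $\alpha\in I$ and a homomorphism $\pi_n\colon\mathbb F_\ell\ast\mathbb F_m\to G_\alpha$ such that (1) $d_\alpha(\pi_n(r),1_\alpha)<1/n$ for every $r\in W$ of length at most $n$; (2) $d_\alpha(\pi_n(w),1_\alpha)>\varepsilon_\alpha-1/n$ for every $w\in\mathbb F_\ell\ast\mathbb F_m$ of length at most $n$ with $\rho(w)\neq 1_G$; (3) $d_\alpha(\pi_n(\bar a_i),a_i^\alpha)<1/n$ for $i=1,\ldots,\ell$.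
   Context: An approximating family $\mathcal F=(G_\alpha,d_\alpha,\varepsilon_\alpha)_{\alpha\in I}$, indexed by an arbitrary set $I$, consists of groups $G_\alpha$ with identity $1_\alpha$, bi-invariant distances $d_\alpha$ on $G_\alpha$, and real numbers $\varepsilon_\alpha>0$ with $\inf_{\alpha\in I}\varepsilon_\alpha>0$. $\mathbb F_\ell$ is the free group on $\bar a_1,\ldots,\bar a_\ell$ and $\mathbb F_m$ the free group on $\bar x_1,\ldots,\bar x_m$; the length of an element of $\mathbb F_\ell\ast\mathbb F_m$ is its word length with respect to $\bar a_1,\ldots,\bar a_\ell,\bar x_1,\ldots,\bar x_m$. For $w\in\mathbb F_\ell\ast\mathbb F_m$ and elements $a_i,h_j$ of a group $H$, $w(a_1,\ldots,a_\ell,h_1,\ldots,h_m)$ is the image of $w$ under the homomorphism $\bar a_i\mapsto a_i$, $\bar x_j\mapsto h_j$. $\langle W\rangle$ is the normal subgroup of $\mathbb F_\ell\ast\mathbb F_m$ generated by $W$. For $\delta>0$, elements $h_1,\ldots,h_m\in G_\alpha$ are a strong $\delta$-solution of $W$ in $G_\alpha$ with coefficients $a_1^\alpha,\ldots,a_\ell^\alpha$ if for all $w\in\mathbb F_\ell\ast\mathbb F_m$ of length at most $1/\delta$: $d_\alpha(w(a_1^\alpha,\ldots,a_\ell^\alpha,h_1,\ldots,h_m),1_\alpha)<\delta$ if $w\in W$, and $d_\alpha(w(a_1^\alpha,\ldots,a_\ell^\alpha,h_1,\ldots,h_m),1_\alpha)\geqslant\varepsilon_\alpha-\delta$ if $w\notin\langle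 W\rangle$. The group $G=\mathbb F_\ell\ast\mathbb F_m/\langle W\rangle$ is constraint $\mathcal F$-approximable with respect to $a_1^\alpha,\ldots,a_\ell^\alpha\in G_\alpha$, $\alpha\in I$, if $W$ is, that is, if for every $\delta>0$ there is $\alpha\in I$ such that $W$ has a strong $\delta$-solution in $G_\alpha$ with coefficients $a_1^\alpha,\ldots,a_\ell^\alpha$. *)

theory Defs
  imports
    "HOL-Algebra.Coset"
    "HOL-Library.Extended_Real"
    "HOL-Analysis.Abstract_Metric_Spaces"
begin

section \<open>Free groups\<close>

text \<open>
  A letter \<open>(s, True)\<close> stands for the generator \<open>s\<close> and \<open>(s, False)\<close> for its inverse. The free
  group on \<open>S\<close> consists of the freely reduced words in these letters; the product of two reduced
  words is the free reduction of their concatenation.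
\<close>

definition inv_letter :: "'g \<times> bool \<Rightarrow> 'g \<times> bool" where
  "inv_letter x = (fst x, \<not> snd x)"

definition reduced :: "('g \<times> bool) list \<Rightarrow> bool" where
  "reduced w \<longleftrightarrow> successively (\<lambda>x y. y \<noteq> inv_letter x) w"

fun push_letter :: "'g \<times> bool \<Rightarrow> ('g \<times> bool) list \<Rightarrow> ('g \<times> bool) list" where
  "push_letter x [] = [x]"
| "push_letter x (y # w) = (if y = inv_letter x then w else x # y # w)"

definition free_group :: "'g set \<Rightarrow> ('g \<times> bool) list monoid" where
  "free_group S =
     \<lparr>carrier = {w. fst ` set w \<subseteq> S \<and> reduced w}, mult = foldr push_letter, one = []\<rparr>"

definition free_gen :: "'g \<Rightarrow> ('g \<times> bool) list" where
  "free_gen s = [(s, True)]"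

text \<open>The homomorphism from a free group to \<open>H\<close> that sends each generator \<open>s\<close> to \<open>f s\<close>.\<close>

definition free_lift :: "('a, 'b) monoid_scheme \<Rightarrow> ('g \<Rightarrow> 'a) \<Rightarrow> ('g \<times> bool) list \<Rightarrow> 'a" where
  "free_lift H f w =
     foldr (\<lambda>x r. (if snd x then f (fst x) else inv\<^bsub>H\<^esub> f (fst x)) \<otimes>\<^bsub>H\<^esub> r) w \<one>\<^bsub>H\<^esub>"

lemma inv_letter_simps [simp]:
  "fst (inv_letter x) = fst x" "snd (inv_letter x) = (\<not> snd x)" "inv_letter (inv_letter x) = x"
  by (simp_all add: inv_letter_def)

lemma reduced_Nil [simp]: "reduced []"
  and reduced_Cons: "reduced (x # w) \<longleftrightarrow> (w = [] \<or> hd w \<noteq> inv_letter x) \<and> reduced w"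
  by (auto simp: reduced_def successively_Cons)

lemma reduced_push_letter: "reduced w \<Longrightarrow> reduced (push_letter x w)"
  by (cases w) (auto simp: reduced_Cons)

lemma push_letter_inv: "reduced w \<Longrightarrow> push_letter x (push_letter (inv_letter x) w) = w"
proof (cases w)
  case (Cons y v)
  assume "reduced w"
  with Cons show ?thesis by (cases v) (auto simp: reduced_Cons)
qed simp

lemma reduced_foldr_push: "reduced w \<Longrightarrow> reduced (foldr push_letter u w)"
  by (induction u) (auto simp: reduced_push_letter)

lemma foldr_push_push:
  "reduced w \<Longrightarrow> foldr push_letter (push_letter x t) w = push_letter x (foldr push_letter t w)"
  by (cases t) (auto simp: push_letter_inv reduced_foldr_push)

lemma foldr_push_assoc:
  "reduced w \<Longrightarrow>
    foldr push_letter (foldr push_letter u v) w = foldr push_letter u (foldr push_letter v w)"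
  by (induction u) (auto simp: foldr_push_push)

lemma push_letter_reduced: "reduced (x # w) \<Longrightarrow> push_letter x w = x # w"
  by (cases w) (auto simp: reduced_Cons)

lemma foldr_push_Nil: "reduced w \<Longrightarrow> foldr push_letter w [] = w"
  by (induction w) (auto simp: push_letter_reduced reduced_Cons)

lemma set_foldr_push: "set (foldr push_letter u w) \<subseteq> set u \<union> set w"
proof (induction u)
  case (Cons x u)
  have "set (push_letter x v) \<subseteq> insert x (set v)" for v
    by (cases v) auto
  with Cons show ?case by fastforce
qed simp

lemma foldr_push_inv: "foldr push_letter (rev (map inv_letter u)) u = []"
  by (induction u) auto

lemma reduced_rev_inv: "reduced u \<Longrightarrow> reduced (rev (map inv_letter u))"
  unfolding reduced_def successively_rev successively_map
  by (erule successively_mono) (metis inv_letter_simps(3))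

lemma group_free_group: "group (free_group S)"
proof (rule groupI)
  show "\<And>x y. \<lbrakk>x \<in> carrier (free_group S); y \<in> carrier (free_group S)\<rbrakk>
      \<Longrightarrow> x \<otimes>\<^bsub>free_group S\<^esub> y \<in> carrier (free_group S)"
    using set_foldr_push by (fastforce simp: free_group_def reduced_foldr_push)
  show "\<exists>y\<in>carrier (free_group S). y \<otimes>\<^bsub>free_group S\<^esub> x = \<one>\<^bsub>free_group S\<^esub>"
    if "x \<in> carrier (free_group S)" for x
    using that foldr_push_inv[of x] reduced_rev_inv[of x]
    by (intro bexI[of _ "rev (map inv_letter x)"]) (auto simp: free_group_def)
qed (auto simp: free_group_def foldr_push_assoc)

lemma free_gen_in_carrier: "s \<in> S \<Longrightarrow> free_gen s \<in> carrier (free_group S)"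
  by (simp add: free_group_def free_gen_def reduced_Cons)

lemma inv_free_gen: "s \<in> S \<Longrightarrow> inv\<^bsub>free_group S\<^esub> (free_gen s) = [(s, False)]"
  by (intro group.inv_equality[OF group_free_group])
     (auto simp: free_group_def free_gen_def reduced_Cons inv_letter_def)

lemma free_lift_Cons:
  "free_lift H f (x # w) =
     (if snd x then f (fst x) else inv\<^bsub>H\<^esub> f (fst x)) \<otimes>\<^bsub>H\<^esub> free_lift H f w"
  by (simp add: free_lift_def)

lemma free_lift_closed:
  assumes "group H" "f \<in> S \<rightarrow> carrier H" "fst ` set w \<subseteq> S"
  shows "free_lift H f w \<in> carrier H"
proof -
  interpret group H by fact
  show ?thesis
    using assms(3) by (induction w) (use assms(2) in \<open>auto simp: free_lift_def Pi_iff\<close>)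
qed

lemma free_lift_push:
  assumes "group H" "f \<in> S \<rightarrow> carrier H" "fst ` set (x # w) \<subseteq> S"
  shows "free_lift H f (push_letter x w) = free_lift H f (x # w)"
proof (cases w)
  case (Cons y v)
  interpret group H by fact
  have "f (fst x) \<in> carrier H" "free_lift H f v \<in> carrier H"
    using assms Cons free_lift_closed[of H f S v] by auto
  then show ?thesis
    using Cons by (cases "snd x") (auto simp: free_lift_Cons inv_letter_def m_assoc[symmetric])
qed simp

lemma free_lift_hom:
  assumes "group H" "f \<in> S \<rightarrow> carrier H"
  shows "free_lift H f \<in> hom (free_group S) H"
proof (rule homI)
  interpret group H by fact
  fix u v assume *: "u \<in> carrier (free_group S)" "v \<in> carrier (free_group S)"
  have "free_lift H f (foldr push_letter u v) = free_lift H f u \<otimes>\<^bsub>H\<^esub> free_lift H f v"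
    if "fst ` set u \<subseteq> S" "fst ` set v \<subseteq> S" for u v
    using that
  proof (induction u)
    case Nil
    then show ?case using free_lift_closed[OF assms, of v] by (simp add: free_lift_def)
  next
    case (Cons x u)
    have "fst ` set (foldr push_letter u v) \<subseteq> S"
      using set_foldr_push[of u v] Cons.prems by fastforce
    then have "free_lift H f (foldr push_letter (x # u) v)
        = free_lift H f (x # foldr push_letter u v)"
      using Cons.prems by (simp add: free_lift_push[OF assms])
    moreover have "f (fst x) \<in> carrier H"
      using Cons.prems assms(2) by auto
    ultimately show ?case
      using Cons free_lift_closed[OF assms, of u] free_lift_closed[OF assms, of v]
      by (auto simp: free_lift_Cons m_assoc)
  qed
  with * show "free_lift H f (u \<otimes>\<^bsub>free_group S\<^esub> v) = free_lift H f u \<otimes>\<^bsub>H\<^esub> free_lift H f v"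
    by (simp add: free_group_def)
qed (auto simp: free_group_def intro: free_lift_closed[OF assms])

lemma free_lift_gen:
  assumes "group H" "f s \<in> carrier H"
  shows "free_lift H f (free_gen s) = f s"
proof -
  interpret group H by fact
  show ?thesis using assms(2) by (simp add: free_lift_def free_gen_def)
qed

lemma free_lift_unique:
  assumes "group H" "\<phi> \<in> hom (free_group S) H" "w \<in> carrier (free_group S)"
  shows "\<phi> w = free_lift H (\<lambda>s. \<phi> (free_gen s)) w"
proof -
  interpret group_hom "free_group S" H \<phi>
    using assms by (auto simp: group_hom_def group_hom_axioms_def group_free_group)
  show ?thesis
    using assms(3)
  proof (induction w)
    case Nil
    then show ?case using hom_one by (simp add: free_lift_def free_group_def)
  next
    case (Cons x w)
    have x: "fst x \<in> S" and w: "w \<in> carrier (free_group S)" and r: "reduced (x # w)"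
      using Cons.prems by (auto simp: free_group_def reduced_Cons)
    have x': "[x] \<in> carrier (free_group S)"
      using x by (simp add: free_group_def reduced_Cons)
    have "x # w = [x] \<otimes>\<^bsub>free_group S\<^esub> w"
      using r by (simp add: free_group_def push_letter_reduced)
    then have "\<phi> (x # w) = \<phi> [x] \<otimes>\<^bsub>H\<^esub> \<phi> w"
      using x' w by simp
    moreover have "\<phi> [x] = (if snd x then \<phi> (free_gen (fst x)) else inv\<^bsub>H\<^esub> \<phi> (free_gen (fst x)))"
    proof (cases "snd x")
      case True
      then show ?thesis by (cases x) (simp add: free_gen_def)
    next
      case False
      then have "[x] = inv\<^bsub>free_group S\<^esub> (free_gen (fst x))"
        using x by (cases x) (simp add: inv_free_gen)
      then show ?thesis
        using False x by (simp add: free_gen_in_carrier)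
    qed
    ultimately show ?case
      using Cons.IH[OF w] by (simp add: free_lift_Cons)
  qed
qed

section \<open>Word length and normal closure\<close>

definition word_length :: "('a, 'b) monoid_scheme \<Rightarrow> 'a set \<Rightarrow> 'a \<Rightarrow> nat" where
  "word_length G X g =
     (LEAST n. \<exists>us. length us = n \<and> set us \<subseteq> X \<union> m_inv G ` X \<and> foldr (mult G) us \<one>\<^bsub>G\<^esub> = g)"

definition normal_closure :: "('a, 'b) monoid_scheme \<Rightarrow> 'a set \<Rightarrow> 'a set" where
  "normal_closure G W = \<Inter>{N. N \<lhd> G \<and> W \<subseteq> N}"

lemma word_length_free_group:
  assumes "w \<in> carrier (free_group S)"
  shows "word_length (free_group S) (free_gen ` S) w = length w"
  unfolding word_length_def
proof (rule Least_equality)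
  have [simp]: "foldr (mult (free_group S)) (map (\<lambda>x. [x]) v) \<one>\<^bsub>free_group S\<^esub>
      = foldr push_letter v []" for v
    by (induction v) (auto simp: free_group_def)
  have "[x] \<in> free_gen ` S \<union> m_inv (free_group S) ` free_gen ` S" if "x \<in> set w" for x
  proof -
    have x: "fst x \<in> S" using that assms by (auto simp: free_group_def)
    then show ?thesis
    proof (cases "snd x")
      case True
      then have "[x] = free_gen (fst x)" by (cases x) (simp add: free_gen_def)
      with x show ?thesis by blast
    next
      case False
      then have "[x] = inv\<^bsub>free_group S\<^esub> (free_gen (fst x))"
        using x by (cases x) (simp add: inv_free_gen)
      with x show ?thesis by blast
    qed
  qed
  moreover have "foldr push_letter w [] = w"
    using assms by (simp add: free_group_def foldr_push_Nil)
  ultimately show "\<exists>us. length us = length w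
      \<and> set us \<subseteq> free_gen ` S \<union> m_inv (free_group S) ` free_gen ` S
      \<and> foldr (mult (free_group S)) us \<one>\<^bsub>free_group S\<^esub> = w"
    by (intro exI[of _ "map (\<lambda>x. [x]) w"]) auto
next
  fix n
  have len: "length (push_letter x v) \<le> Suc (length v)" for x :: "'a \<times> bool" and v
    by (cases v) auto
  have "length (foldr (mult (free_group S)) us \<one>\<^bsub>free_group S\<^esub>) \<le> length us"
    if "set us \<subseteq> free_gen ` S \<union> m_inv (free_group S) ` free_gen ` S" for us
    using that
  proof (induction us)
    case (Cons u us)
    obtain x where "u = [x]"
      using Cons.prems by (auto simp: inv_free_gen) (auto simp: free_gen_def)
    then show ?case
      using Cons len[of x "foldr (mult (free_group S)) us \<one>\<^bsub>free_group S\<^esub>"]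
      by (simp add: free_group_def)
  qed (simp add: free_group_def)
  then show "\<exists>us. length us = n
      \<and> set us \<subseteq> free_gen ` S \<union> m_inv (free_group S) ` free_gen ` S
      \<and> foldr (mult (free_group S)) us \<one>\<^bsub>free_group S\<^esub> = w \<Longrightarrow> length w \<le> n"
    by auto
qed

lemma normal_closure_normal:
  assumes "group G" "W \<subseteq> carrier G"
  shows "normal_closure G W \<lhd> G"
proof -
  interpret group G by fact
  have "carrier G \<lhd> G"
    by (simp add: normal_inv_iff subgroup_self)
  with assms(2) have ne: "{N. N \<lhd> G \<and> W \<subseteq> N} \<noteq> {}" by blast
  show ?thesis
    unfolding normal_closure_def normal_inv_iff
    using ne by (auto simp: normal_inv_iff intro!: subgroups_Inter)
qed

section \<open>The free product of two free groups\<close>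

text \<open>
  The free product of the free groups on \<open>{1..l}\<close> and on \<open>{1..m}\<close> is realised as the free group on
  the disjoint union of the two sets of generators; the next lemma is its universal property.
\<close>

definition FF :: "nat \<Rightarrow> nat \<Rightarrow> ((nat + nat) \<times> bool) list monoid" where
  "FF l m = free_group ({1..l} <+> {1..m})"

abbreviation abar :: "nat \<Rightarrow> ((nat + nat) \<times> bool) list" where
  "abar i \<equiv> free_gen (Inl i)"

abbreviation xbar :: "nat \<Rightarrow> ((nat + nat) \<times> bool) list" where
  "xbar j \<equiv> free_gen (Inr j)"

definition len :: "nat \<Rightarrow> nat \<Rightarrow> ((nat + nat) \<times> bool) list \<Rightarrow> nat" where
  "len l m = word_length (FF l m) (abar ` {1..l} \<union> xbar ` {1..m})"

definition eval_word ::
  "('a, 'b) monoid_scheme \<Rightarrow> (nat \<Rightarrow> 'a) \<Rightarrow> (nat \<Rightarrow> 'a) \<Rightarrow> ((nat + nat) \<times> bool) list \<Rightarrow> 'a" where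
  "eval_word H a h = free_lift H (case_sum a h)"

lemma FF_free_product:
  fixes l m :: nat and H :: "('a, 'b) monoid_scheme"
  defines "\<iota>\<^sub>1 \<equiv> map (apfst Inl)" and "\<iota>\<^sub>2 \<equiv> map (apfst Inr)"
  assumes "group H" "\<phi> \<in> hom (free_group {1..l}) H" "\<psi> \<in> hom (free_group {1..m}) H"
  shows "\<iota>\<^sub>1 \<in> hom (free_group {1..l}) (FF l m)"
    and "\<iota>\<^sub>2 \<in> hom (free_group {1..m}) (FF l m)"
    and "\<exists>\<theta> \<in> hom (FF l m) H.
          (\<forall>u \<in> carrier (free_group {1..l}). \<theta> (\<iota>\<^sub>1 u) = \<phi> u) \<and>
          (\<forall>v \<in> carrier (free_group {1..m}). \<theta> (\<iota>\<^sub>2 v) = \<psi> v)"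
    and "\<lbrakk>\<theta> \<in> hom (FF l m) H; \<theta>' \<in> hom (FF l m) H;
          \<And>u. u \<in> carrier (free_group {1..l}) \<Longrightarrow> \<theta> (\<iota>\<^sub>1 u) = \<theta>' (\<iota>\<^sub>1 u);
          \<And>v. v \<in> carrier (free_group {1..m}) \<Longrightarrow> \<theta> (\<iota>\<^sub>2 v) = \<theta>' (\<iota>\<^sub>2 v);
          w \<in> carrier (FF l m)\<rbrakk> \<Longrightarrow> \<theta> w = \<theta>' w"
proof -
  have red: "reduced (map (apfst g) w) \<longleftrightarrow> reduced w" if "inj g"
    for g :: "nat \<Rightarrow> nat + nat" and w
    using inj_eq[OF that] unfolding reduced_def successively_map
    by (intro successively_cong) (auto simp: inv_letter_def)
  have push: "map (apfst g) (push_letter x w)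
      = push_letter (apfst g x) (map (apfst g) w)" if "inj g"
    for g :: "nat \<Rightarrow> nat + nat" and x w
    using inj_eq[OF that] by (cases w) (auto simp: inv_letter_def)
  have fold: "map (apfst g) (foldr push_letter u w)
      = foldr push_letter (map (apfst g) u) (map (apfst g) w)" if "inj g"
    for g :: "nat \<Rightarrow> nat + nat" and u w
    by (induction u) (simp_all add: push[OF that])
  show "\<iota>\<^sub>1 \<in> hom (free_group {1..l}) (FF l m)" "\<iota>\<^sub>2 \<in> hom (free_group {1..m}) (FF l m)"
    unfolding \<iota>\<^sub>1_def \<iota>\<^sub>2_def FF_def
    by (rule homI; force simp: free_group_def fold red)+
  define f where "f = case_sum (\<lambda>i. \<phi> (free_gen i)) (\<lambda>j. \<psi> (free_gen j))"
  have f: "f \<in> ({1..l} <+> {1..m}) \<rightarrow> carrier H"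
  proof
    fix s assume "s \<in> {1..l} <+> {1..m}"
    then show "f s \<in> carrier H"
      using hom_in_carrier[OF assms(4) free_gen_in_carrier]
        hom_in_carrier[OF assms(5) free_gen_in_carrier]
      by (cases s) (auto simp: f_def)
  qed
  have lift: "free_lift H f (map (apfst g) w) = free_lift H (f \<circ> g) w"
    for g :: "nat \<Rightarrow> nat + nat" and w
    by (induction w) (simp_all add: free_lift_def)
  have f_Inl: "f \<circ> Inl = (\<lambda>i. \<phi> (free_gen i))" and f_Inr: "f \<circ> Inr = (\<lambda>j. \<psi> (free_gen j))"
    by (simp_all add: f_def o_def)
  show "\<exists>\<theta> \<in> hom (FF l m) H.
          (\<forall>u \<in> carrier (free_group {1..l}). \<theta> (\<iota>\<^sub>1 u) = \<phi> u) \<and>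
          (\<forall>v \<in> carrier (free_group {1..m}). \<theta> (\<iota>\<^sub>2 v) = \<psi> v)"
  proof (intro bexI conjI ballI)
    show "free_lift H f \<in> hom (FF l m) H"
      unfolding FF_def by (rule free_lift_hom[OF assms(3) f])
    show "free_lift H f (\<iota>\<^sub>1 u) = \<phi> u" if "u \<in> carrier (free_group {1..l})" for u
      using free_lift_unique[OF assms(3,4) that] by (simp add: \<iota>\<^sub>1_def lift f_Inl)
    show "free_lift H f (\<iota>\<^sub>2 v) = \<psi> v" if "v \<in> carrier (free_group {1..m})" for v
      using free_lift_unique[OF assms(3,5) that] by (simp add: \<iota>\<^sub>2_def lift f_Inr)
  qed
  assume *: "\<theta> \<in> hom (FF l m) H" "\<theta>' \<in> hom (FF l m) H"
    "\<And>u. u \<in> carrier (free_group {1..l}) \<Longrightarrow> \<theta> (\<iota>\<^sub>1 u) = \<theta>' (\<iota>\<^sub>1 u)"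
    "\<And>v. v \<in> carrier (free_group {1..m}) \<Longrightarrow> \<theta> (\<iota>\<^sub>2 v) = \<theta>' (\<iota>\<^sub>2 v)"
    "w \<in> carrier (FF l m)"
  have gens: "\<theta> (free_gen s) = \<theta>' (free_gen s)" if "s \<in> {1..l} <+> {1..m}" for s
    using that *(3,4)[OF free_gen_in_carrier]
    by (auto simp: \<iota>\<^sub>1_def \<iota>\<^sub>2_def free_gen_def)
  have "free_lift H (\<lambda>s. \<theta> (free_gen s)) w = free_lift H (\<lambda>s. \<theta>' (free_gen s)) w"
    unfolding free_lift_def
  proof (rule foldr_cong)
    fix x r assume "x \<in> set w"
    then have "fst x \<in> {1..l} <+> {1..m}"
      using *(5) by (auto simp: FF_def free_group_def)
    then show "(if snd x then \<theta> (free_gen (fst x)) else inv\<^bsub>H\<^esub> \<theta> (free_gen (fst x))) \<otimes>\<^bsub>H\<^esub> r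
        = (if snd x then \<theta>' (free_gen (fst x)) else inv\<^bsub>H\<^esub> \<theta>' (free_gen (fst x))) \<otimes>\<^bsub>H\<^esub> r"
      by (simp only: gens)
  qed simp_all
  then show "\<theta> w = \<theta>' w"
    using free_lift_unique[OF assms(3)] *(1,2,5) by (metis FF_def)
qed

lemma len_eq_length: "w \<in> carrier (FF l m) \<Longrightarrow> len l m w = length w"
proof -
  have "abar ` {1..l} \<union> xbar ` {1..m} = free_gen ` ({1..l} <+> {1..m})"
    by (auto simp: Plus_def)
  then show "w \<in> carrier (FF l m) \<Longrightarrow> len l m w = length w"
    by (simp add: len_def FF_def word_length_free_group)
qed

section \<open>Approximating families\<close>

text \<open>
  The groups are allowed different carriers inside one type, which loses no generality, as any
  family of groups embeds into the disjoint union of its members. The infimum is taken in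
  \<open>ereal\<close>, so that it is \<open>\<infinity>\<close> for the empty family.
\<close>

locale approximating_family =
  fixes I :: "'i set"
    and G :: "'i \<Rightarrow> ('a, 'b) monoid_scheme"
    and d :: "'i \<Rightarrow> 'a \<Rightarrow> 'a \<Rightarrow> real"
    and \<epsilon> :: "'i \<Rightarrow> real"
  assumes groups: "\<And>\<alpha>. \<alpha> \<in> I \<Longrightarrow> group (G \<alpha>)"
    and metrics: "\<And>\<alpha>. \<alpha> \<in> I \<Longrightarrow> Metric_space (carrier (G \<alpha>)) (d \<alpha>)"
    and left_invariant: "\<And>\<alpha> g x y. \<lbrakk>\<alpha> \<in> I; g \<in> carrier (G \<alpha>); x \<in> carrier (G \<alpha>); y \<in> carrier (G \<alpha>)\<rbrakk>
        \<Longrightarrow> d \<alpha> (g \<otimes>\<^bsub>G \<alpha>\<^esub> x) (g \<otimes>\<^bsub>G \<alpha>\<^esub> y) = d \<alpha> x y"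
    and right_invariant: "\<And>\<alpha> g x y. \<lbrakk>\<alpha> \<in> I; g \<in> carrier (G \<alpha>); x \<in> carrier (G \<alpha>); y \<in> carrier (G \<alpha>)\<rbrakk>
        \<Longrightarrow> d \<alpha> (x \<otimes>\<^bsub>G \<alpha>\<^esub> g) (y \<otimes>\<^bsub>G \<alpha>\<^esub> g) = d \<alpha> x y"
    and eps_pos: "\<And>\<alpha>. \<alpha> \<in> I \<Longrightarrow> \<epsilon> \<alpha> > 0"
    and inf_eps_pos: "(INF \<alpha>\<in>I. ereal (\<epsilon> \<alpha>)) > 0"

definition strong_solution ::
  "('a, 'b) monoid_scheme \<Rightarrow> ('a \<Rightarrow> 'a \<Rightarrow> real) \<Rightarrow> real \<Rightarrow> nat \<Rightarrow> nat \<Rightarrow>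
   ((nat + nat) \<times> bool) list set \<Rightarrow> (nat \<Rightarrow> 'a) \<Rightarrow> real \<Rightarrow> (nat \<Rightarrow> 'a) \<Rightarrow> bool" where
  "strong_solution H dist\<^sub>H eps l m W a \<delta> h \<longleftrightarrow>
     (\<forall>j\<in>{1..m}. h j \<in> carrier H) \<and>
     (\<forall>w\<in>carrier (FF l m). real (len l m w) \<le> 1 / \<delta> \<longrightarrow>
        (w \<in> W \<longrightarrow> dist\<^sub>H (eval_word H a h w) \<one>\<^bsub>H\<^esub> < \<delta>) \<and>
        (w \<notin> normal_closure (FF l m) W \<longrightarrow> dist\<^sub>H (eval_word H a h w) \<one>\<^bsub>H\<^esub> \<ge> eps - \<delta>))"

text \<open>
  Approximability of the group \<open>FF l m Mod normal_closure (FF l m) W\<close> is by definition that of the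
  system \<open>W\<close> presenting it.
\<close>

definition constraint_approximable ::
  "'i set \<Rightarrow> ('i \<Rightarrow> ('a, 'b) monoid_scheme) \<Rightarrow> ('i \<Rightarrow> 'a \<Rightarrow> 'a \<Rightarrow> real) \<Rightarrow> ('i \<Rightarrow> real) \<Rightarrow>
   nat \<Rightarrow> nat \<Rightarrow> ((nat + nat) \<times> bool) list set \<Rightarrow> ('i \<Rightarrow> nat \<Rightarrow> 'a) \<Rightarrow> bool" where
  "constraint_approximable I G d \<epsilon> l m W a \<longleftrightarrow>
     (\<forall>\<delta>>0. \<exists>\<alpha>\<in>I. \<exists>h. strong_solution (G \<alpha>) (d \<alpha>) (\<epsilon> \<alpha>) l m W (a \<alpha>) \<delta> h)"

text \<open>The presented group and the canonical projection onto it.\<close>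

definition presented_group ::
  "nat \<Rightarrow> nat \<Rightarrow> ((nat + nat) \<times> bool) list set \<Rightarrow> ((nat + nat) \<times> bool) list set monoid" where
  "presented_group l m W = FF l m Mod normal_closure (FF l m) W"

definition proj ::
  "nat \<Rightarrow> nat \<Rightarrow> ((nat + nat) \<times> bool) list set \<Rightarrow>
   ((nat + nat) \<times> bool) list \<Rightarrow> ((nat + nat) \<times> bool) list set" where
  "proj l m W w = normal_closure (FF l m) W #>\<^bsub>FF l m\<^esub> w"

end

theory Submission
  imports Defs
begin

text \<open>
  Both conditions ask for a homomorphism from the free product to some \<open>G \<alpha>\<close> that almost kills the
  short words of \<open>W\<close> and keeps the short words outside the normal closure away from the identity.
  They differ in how the generators \<open>abar i\<close> are treated: a strong solution sends them exactly to
  the coefficients, while the homomorphisms of the second condition do so only up to \<open>1 / n\<close>.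

  From a strong solution one gets the homomorphism by evaluation. Conversely, replace the
  values of a homomorphism \<open>\<pi>\<close> on the \<open>abar i\<close> by the coefficients and keep its values on the
  \<open>xbar j\<close>. As the distance is bi-invariant, the errors in the letters of a word only add up
  (\<open>dist_free_lift_le\<close>), so on words of length at most \<open>1 / \<delta>\<close> the evaluation differs from \<open>\<pi>\<close> by
  at most \<open>(1 / \<delta>) / n\<close>. The length bound does not depend on \<open>n\<close>, so a large \<open>n\<close> makes the total
  error smaller than \<open>\<delta>\<close>.
\<close>

locale bi_invariant_metric_group = group H + Metric_space "carrier H" D
  for H :: "('a, 'b) monoid_scheme" (structure) and D :: "'a \<Rightarrow> 'a \<Rightarrow> real" +
  assumes dist_mult_left:
      "\<lbrakk>g \<in> carrier H; x \<in> carrier H; y \<in> carrier H\<rbrakk> \<Longrightarrow> D (g \<otimes> x) (g \<otimes> y) = D x y"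
    and dist_mult_right:
      "\<lbrakk>g \<in> carrier H; x \<in> carrier H; y \<in> carrier H\<rbrakk> \<Longrightarrow> D (x \<otimes> g) (y \<otimes> g) = D x y"
begin

lemma dist_inv:
  assumes [simp]: "x \<in> carrier H" "y \<in> carrier H"
  shows "D (inv x) (inv y) = D x y"
proof -
  have "D (inv x) (inv y) = D (x \<otimes> inv x \<otimes> y) (x \<otimes> inv y \<otimes> y)"
    by (simp only: dist_mult_left dist_mult_right assms inv_closed m_closed)
  also have "\<dots> = D y x"
    by (simp add: m_assoc)
  finally show ?thesis
    by (simp add: commute)
qed

lemma dist_mult_le:
  assumes [simp]: "x \<in> carrier H" "y \<in> carrier H" "u \<in> carrier H" "v \<in> carrier H"
  shows "D (x \<otimes> u) (y \<otimes> v) \<le> D x y + D u v"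
proof -
  have "D (x \<otimes> u) (y \<otimes> v) \<le> D (x \<otimes> u) (y \<otimes> u) + D (y \<otimes> u) (y \<otimes> v)"
    by (rule triangle) auto
  then show ?thesis
    by (simp add: dist_mult_left dist_mult_right)
qed

text \<open>
  Each letter of the word costs at most \<open>\<eta>\<close>: multiplying does not increase the sum of the errors,
  and an inverse letter has the same error as its generator.
\<close>

lemma dist_free_lift_le:
  fixes f :: "'g \<Rightarrow> 'a"
  assumes f: "f \<in> S \<rightarrow> carrier H" and g: "g \<in> S \<rightarrow> carrier H"
    and close: "\<And>s. s \<in> S \<Longrightarrow> D (f s) (g s) \<le> \<eta>"
    and w: "fst ` set w \<subseteq> S"
  shows "D (free_lift H f w) (free_lift H g w) \<le> real (length w) * \<eta>"
  using w
proof (induction w)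
  case Nil
  then show ?case by (simp add: free_lift_def)
next
  case (Cons x w)
  define F where "F k = (if snd x then k (fst x) else inv k (fst x))" for k :: "'g \<Rightarrow> 'a"
  have x: "fst x \<in> S" and w: "fst ` set w \<subseteq> S" using Cons.prems by auto
  have gens: "f (fst x) \<in> carrier H" "g (fst x) \<in> carrier H" using f g x by auto
  have "D (F f) (F g) \<le> \<eta>"
    using gens close[OF x] by (simp add: F_def dist_inv)
  moreover have "D (F f \<otimes> free_lift H f w) (F g \<otimes> free_lift H g w)
      \<le> D (F f) (F g) + D (free_lift H f w) (free_lift H g w)"
    using gens free_lift_closed[OF is_group f w] free_lift_closed[OF is_group g w]
    by (intro dist_mult_le) (auto simp: F_def)
  ultimately show ?case
    using Cons.IH[OF w] by (simp add: free_lift_Cons F_def algebra_simps)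
qed

end

lemma (in approximating_family) bi_invariant_metric_group:
  "\<alpha> \<in> I \<Longrightarrow> bi_invariant_metric_group (G \<alpha>) (d \<alpha>)"
  by (simp add: bi_invariant_metric_group_def bi_invariant_metric_group_axioms_def
      groups metrics left_invariant right_invariant)

lemma proj_eq_one_iff:
  assumes "W \<subseteq> carrier (FF l m)" "w \<in> carrier (FF l m)"
  shows "proj l m W w = \<one>\<^bsub>presented_group l m W\<^esub> \<longleftrightarrow> w \<in> normal_closure (FF l m) W"
proof -
  have grp: "group (FF l m)"
    by (simp add: FF_def group_free_group)
  then have sub: "subgroup (normal_closure (FF l m) W) (FF l m)"
    using normal_closure_normal[OF grp assms(1)] by (simp add: group.normal_inv_iff)
  show ?thesis
    using group.coset_join1[OF grp _ assms(2) sub] group.coset_join2[OF grp assms(2) sub]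
      subgroup.subset[OF sub]
    by (auto simp: proj_def presented_group_def FactGroup_def)
qed

lemma strong_solution_imp_hom:
  assumes "group H" "\<And>i. i \<in> {1..l} \<Longrightarrow> a i \<in> carrier H"
    and sol: "strong_solution H D eps l m W a \<delta> h"
  shows "eval_word H a h \<in> hom (FF l m) H"
    and "i \<in> {1..l} \<Longrightarrow> eval_word H a h (abar i) = a i"
proof -
  have "case_sum a h \<in> ({1..l} <+> {1..m}) \<rightarrow> carrier H"
    using assms(2) sol by (auto simp: strong_solution_def)
  then show "eval_word H a h \<in> hom (FF l m) H"
    unfolding eval_word_def FF_def by (rule free_lift_hom[OF assms(1)])
  show "eval_word H a h (abar i) = a i" if "i \<in> {1..l}"
    using that assms(2) by (simp add: eval_word_def free_lift_gen[OF assms(1)])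
qed

text \<open>
  The error in the generators \<open>abar i\<close> is the only one, since the \<open>xbar j\<close> keep their images.
\<close>

lemma (in bi_invariant_metric_group) dist_eval_word_hom_le:
  assumes hom: "\<pi> \<in> hom (FF l m) H"
    and a: "\<And>i. i \<in> {1..l} \<Longrightarrow> a i \<in> carrier H"
    and close: "\<And>i. i \<in> {1..l} \<Longrightarrow> D (\<pi> (abar i)) (a i) \<le> \<eta>" and "\<eta> \<ge> 0"
    and w: "w \<in> carrier (FF l m)"
  shows "D (eval_word H a (\<lambda>j. \<pi> (xbar j)) w) (\<pi> w) \<le> real (len l m w) * \<eta>"
proof -
  let ?S = "{1..l} <+> {1..m}"
  have img: "(\<lambda>s. \<pi> (free_gen s)) \<in> ?S \<rightarrow> carrier H"
    using hom_in_carrier[OF hom] free_gen_in_carrier[of _ ?S] by (auto simp: FF_def)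
  have "D (free_lift H (case_sum a (\<lambda>j. \<pi> (xbar j))) w) (free_lift H (\<lambda>s. \<pi> (free_gen s)) w)
      \<le> real (length w) * \<eta>"
  proof (rule dist_free_lift_le[where S = ?S])
    show "case_sum a (\<lambda>j. \<pi> (xbar j)) \<in> ?S \<rightarrow> carrier H"
      using a img by (auto simp: Pi_iff)
    show "D (case s of Inl i \<Rightarrow> a i | Inr j \<Rightarrow> \<pi> (xbar j)) (\<pi> (free_gen s)) \<le> \<eta>" if "s \<in> ?S" for s
      using that close img \<open>\<eta> \<ge> 0\<close> by (cases s) (auto simp: commute Pi_iff)
    show "fst ` set w \<subseteq> ?S"
      using w by (simp add: FF_def free_group_def)
  qed (rule img)
  moreover have "\<pi> w = free_lift H (\<lambda>s. \<pi> (free_gen s)) w"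
    using free_lift_unique[OF is_group] hom w by (metis FF_def)
  ultimately show ?thesis
    using w by (simp add: eval_word_def len_eq_length)
qed

text \<open>
  In the conclusion \<open>1 / n\<close> is the error of \<open>\<pi>\<close> itself, and \<open>(1 / \<delta>) / n\<close> bounds the error of
  exchanging the coefficients in a word of length at most \<open>1 / \<delta>\<close>. The bound \<open>1 / \<delta> \<le> n\<close> makes all
  these words short enough for the properties of \<open>\<pi>\<close> to apply.
\<close>

lemma (in bi_invariant_metric_group) strong_solution_of_hom:
  assumes hom: "\<pi> \<in> hom (FF l m) H"
    and a: "\<And>i. i \<in> {1..l} \<Longrightarrow> a i \<in> carrier H"
    and "\<delta> > 0" "1 / \<delta> \<le> real n" "(1 + 1 / \<delta>) / real n \<le> \<delta>"
    and rel: "\<And>r. \<lbrakk>r \<in> W; len l m r \<le> n\<rbrakk> \<Longrightarrow> D (\<pi> r) \<one> < 1 / real n"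
    and nonrel: "\<And>w. \<lbrakk>w \<in> carrier (FF l m); len l m w \<le> n; w \<notin> normal_closure (FF l m) W\<rbrakk>
      \<Longrightarrow> D (\<pi> w) \<one> > eps - 1 / real n"
    and close: "\<And>i. i \<in> {1..l} \<Longrightarrow> D (\<pi> (abar i)) (a i) < 1 / real n"
  shows "strong_solution H D eps l m W a \<delta> (\<lambda>j. \<pi> (xbar j))"
proof -
  let ?h = "\<lambda>j. \<pi> (xbar j)"
  let ?S = "{1..l} <+> {1..m}"
  have h: "\<pi> (xbar j) \<in> carrier H" if "j \<in> {1..m}" for j
    using hom_in_carrier[OF hom] free_gen_in_carrier[of "Inr j" ?S] that by (simp add: FF_def InrI)
  have "(w \<in> W \<longrightarrow> D (eval_word H a ?h w) \<one> < \<delta>) \<and>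
        (w \<notin> normal_closure (FF l m) W \<longrightarrow> D (eval_word H a ?h w) \<one> \<ge> eps - \<delta>)"
    if w: "w \<in> carrier (FF l m)" and short: "real (len l m w) \<le> 1 / \<delta>" for w
  proof -
    have cl: "eval_word H a ?h w \<in> carrier H" "\<pi> w \<in> carrier H"
    proof -
      have "case_sum a ?h \<in> ?S \<rightarrow> carrier H"
        using h a by auto
      then show "eval_word H a ?h w \<in> carrier H"
        using w unfolding eval_word_def
        by (intro free_lift_closed[OF is_group]) (auto simp: FF_def free_group_def)
    qed (rule hom_in_carrier[OF hom w])
    have "D (eval_word H a ?h w) (\<pi> w) \<le> real (len l m w) * (1 / real n)"
      by (rule dist_eval_word_hom_le[OF hom a _ _ w]) (use close in \<open>auto intro: less_imp_le\<close>)
    also have "\<dots> \<le> (1 / \<delta>) * (1 / real n)"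
      using short by (intro mult_right_mono) auto
    also have "\<dots> \<le> \<delta> - 1 / real n"
      using assms(5) by (simp add: add_divide_distrib)
    finally have near: "D (eval_word H a ?h w) (\<pi> w) \<le> \<delta> - 1 / real n" .
    moreover have "len l m w \<le> n"
      using short assms(4) by linarith
    moreover have "D (eval_word H a ?h w) \<one> \<le> D (eval_word H a ?h w) (\<pi> w) + D (\<pi> w) \<one>"
      "D (\<pi> w) \<one> \<le> D (eval_word H a ?h w) (\<pi> w) + D (eval_word H a ?h w) \<one>"
      using triangle[OF cl one_closed] triangle[OF cl(2,1) one_closed] by (simp_all add: commute)
    ultimately show ?thesis
      using rel[of w] nonrel[OF w] by auto
  qed
  with h show ?thesis
    by (simp add: strong_solution_def)
qed

theorem theorem2p13:
  fixes I :: "'i set"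
    and G :: "'i \<Rightarrow> ('a, 'b) monoid_scheme"
    and d :: "'i \<Rightarrow> 'a \<Rightarrow> 'a \<Rightarrow> real"
    and \<epsilon> :: "'i \<Rightarrow> real"
    and l m :: nat
    and a :: "'i \<Rightarrow> nat \<Rightarrow> 'a"
    and W :: "((nat + nat) \<times> bool) list set"
  assumes "approximating_family I G d \<epsilon>"
    and "m \<ge> 1"
    and "\<And>\<alpha> i. \<lbrakk>\<alpha> \<in> I; i \<in> {1..l}\<rbrakk> \<Longrightarrow> a \<alpha> i \<in> carrier (G \<alpha>)"
    and "W \<subseteq> carrier (FF l m)"
    and "finite W"
  shows "constraint_approximable I G d \<epsilon> l m W a \<longleftrightarrow>
    (\<forall>n::nat. n \<ge> 1 \<longrightarrow>
      (\<exists>\<alpha>\<in>I. \<exists>\<pi>\<in>hom (FF l m) (G \<alpha>).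
        (\<forall>r\<in>W. len l m r \<le> n \<longrightarrow> d \<alpha> (\<pi> r) \<one>\<^bsub>G \<alpha>\<^esub> < 1 / real n) \<and>
        (\<forall>w\<in>carrier (FF l m).
           len l m w \<le> n \<and> proj l m W w \<noteq> \<one>\<^bsub>presented_group l m W\<^esub> \<longrightarrow>
             d \<alpha> (\<pi> w) \<one>\<^bsub>G \<alpha>\<^esub> > \<epsilon> \<alpha> - 1 / real n) \<and>
        (\<forall>i\<in>{1..l}. d \<alpha> (\<pi> (abar i)) (a \<alpha> i) < 1 / real n)))"
proof -
  interpret approximating_family I G d \<epsilon> by fact
  have proj: "proj l m W w \<noteq> \<one>\<^bsub>presented_group l m W\<^esub> \<longleftrightarrow> w \<notin> normal_closure (FF l m) W"
    if "w \<in> carrier (FF l m)" for w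
    using proj_eq_one_iff[OF assms(4) that] by simp
  show ?thesis (is "?approx \<longleftrightarrow> ?homs")
  proof
    assume approx: ?approx
    show ?homs
    proof (intro allI impI)
      fix n :: nat
      assume n: "n \<ge> 1"
      \<comment> \<open>A value strictly below \<open>1 / n\<close>, because the lower bound in the second property of \<open>\<pi>\<close> is strict.\<close>
      define \<delta> where "\<delta> = 1 / real (Suc n)"
      have \<delta>: "\<delta> > 0" "\<delta> < 1 / real n" "real n \<le> 1 / \<delta>"
        using n by (auto simp: \<delta>_def field_simps)
      then obtain \<alpha> h where \<alpha>: "\<alpha> \<in> I"
        and sol: "strong_solution (G \<alpha>) (d \<alpha>) (\<epsilon> \<alpha>) l m W (a \<alpha>) \<delta> h"
        using approx by (auto simp: constraint_approximable_def)
      interpret bi_invariant_metric_group "G \<alpha>" "d \<alpha>"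
        by (rule bi_invariant_metric_group[OF \<alpha>])
      let ?\<pi> = "eval_word (G \<alpha>) (a \<alpha>) h"
      note hom = strong_solution_imp_hom[OF is_group assms(3)[OF \<alpha>] sol]
      have "d \<alpha> (?\<pi> r) \<one>\<^bsub>G \<alpha>\<^esub> < 1 / real n" if "r \<in> W" "len l m r \<le> n" for r
      proof -
        have "real (len l m r) \<le> 1 / \<delta>" using that(2) \<delta>(3) by linarith
        then have "d \<alpha> (?\<pi> r) \<one>\<^bsub>G \<alpha>\<^esub> < \<delta>"
          using sol that(1) assms(4) unfolding strong_solution_def by blast
        with \<delta>(2) show ?thesis by linarith
      qed
      moreover have "d \<alpha> (?\<pi> w) \<one>\<^bsub>G \<alpha>\<^esub> > \<epsilon> \<alpha> - 1 / real n"
        if "w \<in> carrier (FF l m)" "len l m w \<le> n" "w \<notin> normal_closure (FF l m) W" for w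
      proof -
        have "real (len l m w) \<le> 1 / \<delta>" using that(2) \<delta>(3) by linarith
        then have "d \<alpha> (?\<pi> w) \<one>\<^bsub>G \<alpha>\<^esub> \<ge> \<epsilon> \<alpha> - \<delta>"
          using sol that(1,3) unfolding strong_solution_def by blast
        with \<delta>(2) show ?thesis by linarith
      qed
      moreover have "d \<alpha> (?\<pi> (abar i)) (a \<alpha> i) < 1 / real n" if "i \<in> {1..l}" for i
        using hom(2)[OF _ that] assms(3)[OF \<alpha> that] n by simp
      ultimately show "\<exists>\<alpha>\<in>I. \<exists>\<pi>\<in>hom (FF l m) (G \<alpha>).
        (\<forall>r\<in>W. len l m r \<le> n \<longrightarrow> d \<alpha> (\<pi> r) \<one>\<^bsub>G \<alpha>\<^esub> < 1 / real n) \<and>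
        (\<forall>w\<in>carrier (FF l m).
           len l m w \<le> n \<and> proj l m W w \<noteq> \<one>\<^bsub>presented_group l m W\<^esub> \<longrightarrow>
             d \<alpha> (\<pi> w) \<one>\<^bsub>G \<alpha>\<^esub> > \<epsilon> \<alpha> - 1 / real n) \<and>
        (\<forall>i\<in>{1..l}. d \<alpha> (\<pi> (abar i)) (a \<alpha> i) < 1 / real n)"
        using \<alpha> hom(1) proj by blast
    qed
  next
    assume homs: ?homs
    show ?approx
      unfolding constraint_approximable_def
    proof (intro allI impI)
      fix \<delta> :: real
      assume \<delta>: "\<delta> > 0"
      obtain n :: nat where n: "max (1 / \<delta>) ((1 + 1 / \<delta>) / \<delta>) < real n"
        using reals_Archimedean2 by blast
      have "1 / \<delta> > 0" using \<delta> by simp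
      with n have "real n > 0" and n': "n \<ge> 1" "1 / \<delta> \<le> real n"
        by linarith+
      have small: "(1 + 1 / \<delta>) / real n \<le> \<delta>"
        using n \<delta> \<open>real n > 0\<close> by (simp add: pos_divide_less_eq pos_divide_le_eq mult.commute)
      obtain \<alpha> \<pi> where \<alpha>: "\<alpha> \<in> I" and \<pi>: "\<pi> \<in> hom (FF l m) (G \<alpha>)"
        and rel: "\<forall>r\<in>W. len l m r \<le> n \<longrightarrow> d \<alpha> (\<pi> r) \<one>\<^bsub>G \<alpha>\<^esub> < 1 / real n"
        and nonrel: "\<forall>w\<in>carrier (FF l m).
           len l m w \<le> n \<and> proj l m W w \<noteq> \<one>\<^bsub>presented_group l m W\<^esub> \<longrightarrow>
             d \<alpha> (\<pi> w) \<one>\<^bsub>G \<alpha>\<^esub> > \<epsilon> \<alpha> - 1 / real n"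
        and close: "\<forall>i\<in>{1..l}. d \<alpha> (\<pi> (abar i)) (a \<alpha> i) < 1 / real n"
        using homs n'(1) by blast
      interpret bi_invariant_metric_group "G \<alpha>" "d \<alpha>"
        by (rule bi_invariant_metric_group[OF \<alpha>])
      have "strong_solution (G \<alpha>) (d \<alpha>) (\<epsilon> \<alpha>) l m W (a \<alpha>) \<delta> (\<lambda>j. \<pi> (xbar j))"
        by (rule strong_solution_of_hom[OF \<pi> assms(3)[OF \<alpha>] \<delta> n'(2) small])
          (use rel nonrel close proj in blast)+
      with \<alpha> show "\<exists>\<alpha>\<in>I. \<exists>h. strong_solution (G \<alpha>) (d \<alpha>) (\<epsilon> \<alpha>) l m W (a \<alpha>) \<delta> h"
        by blast
    qed
  qed
qed

end
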